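(* Let $G$ be a bi-block graph with $N=\sum_{k=1}^r(m_k+n_k)-r+1$ vertices and $r>1$ blocks $K_{m_k,n_k}$, and let $q$ satisfy $q\neq-1$, $q^2(m_k-1)(n_k-1)\neq1$ and $(q+1)^2(m_k-1)(n_k-1)\neq m_kn_k$ for all $k$. Let $\mathscr{D}$ be the $q$-distance matrix of $G$ and $\mathscr{L}$, $\mathbf{x}$, $\lambda_G$ as defined below. Then $\mathscr{D}$ is invertible and $$\mathscr{D}^{-1}=-\mathscr{L}+\frac{1}{\lambda_G}\mathbf{x}\mathbf{x}^T.$$
   Context: $q$ is a real or complex number (the paper calls it an indeterminate). For an integer $\alpha\ge1$, $[\alpha]=1+q+\cdots+q^{\alpha-1}$, $[0]=0$; the $q$-distance matrix $\mathscr{D}$ of a connected graph with vertices $v_1,\dots,v_N$ has $(i,j)$ entry $[d(v_i,v_j)]$, $d$ the shortest-path distance. A bi-block graph is a connected graph each of whose blocks (maximal connected subgraphs without a cut-vertex) is complete bipartite; its blocks are $K_{m_k,n_k}$ with a fixed bipartition $X_k\cup Y_k$, $|X_k|=m_k$, $|Y_k|=n_k$. Let $\hat d(v)$ be the number of blocks containing $v$, and $\Delta_k=q^2(m_k-1)(n_k-1)-1$. Define $\mathbf{x}(v)=\sum_{k:\,v\in X_k}\frac{q(n_k-1)-1}{(q+1)\Delta_k}+\sum_{k:\,v\in Y_k}\frac{q(m_k-1)-1}{(q+1)\Delta_k}-(\hat d(v)-1)$ and $\mathbf{y}(v)=\sum_{k:\,v\in X_k}\frac{n_k-1}{\Delta_k}+\sum_{k:\,v\in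 Y_k}\frac{m_k-1}{\Delta_k}-(\hat d(v)-1)$. Let $\mathbf{A}$ be the $N\times N$ matrix with $(u,v)$ entry $1/\Delta_k$ if $u\sim v$ and the edge $uv$ lies in block $K_{m_k,n_k}$, and $0$ otherwise. Let $\mathbf{B}$ be the $N\times N$ matrix with $(u,v)$ entry $\frac{n_k-1}{\Delta_k}$ if $u\neq v$ and $u,v\in X_k$ for some $k$, $\frac{m_k-1}{\Delta_k}$ if $u\neq v$ and $u,v\in Y_k$ for some $k$, and $0$ otherwise. Define $$\mathscr{L}=\frac{q}{q+1}\mathbf{A}-\frac{q^2}{q+1}\mathbf{B}-\frac{q^2}{q+1}\mathrm{diag}(\mathbf{y})+\frac{1}{q+1}\mathbf{I}_N,\qquad \lambda_G=\sum_{k=1}^r\frac{(q+1)^2(m_k-1)(n_k-1)-m_kn_k}{(q+1)\left(q^2(m_k-1)(n_k-1)-1\right)}.$$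
   Formalization: The formal statement adds the hypothesis that λ_G ≠ 0, which the listed conditions do not imply: for K_{1,1} and K_{2,2} glued at a vertex with q = −2 they all hold but λ_G = 0, so 1/λ_G is undefined. *)

theory Defs
  imports "HOL-Analysis.Analysis"
begin

section \<open>Graphs, blocks and bi-block graphs\<close>

text \<open>
  A finite simple graph is a pair of a vertex set and a symmetric, irreflexive
  relation on it; an undirected edge is represented by its two orientations.
\<close>

type_synonym 'v sgraph = "'v set \<times> 'v rel"

definition simple_graph :: "'v sgraph \<Rightarrow> bool" where
  "simple_graph G \<longleftrightarrow>
     finite (fst G) \<and> snd G \<subseteq> fst G \<times> fst G \<and> sym (snd G) \<and> irrefl (snd G)"

definition is_subgraph :: "'v sgraph \<Rightarrow> 'v sgraph \<Rightarrow> bool" where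
  "is_subgraph H G \<longleftrightarrow>
     simple_graph H \<and> simple_graph G \<and> fst H \<subseteq> fst G \<and> snd H \<subseteq> snd G"

definition connected_graph :: "'v sgraph \<Rightarrow> bool" where
  "connected_graph G \<longleftrightarrow>
     fst G \<noteq> {} \<and> (\<forall>u\<in>fst G. \<forall>v\<in>fst G. (u, v) \<in> (snd G)\<^sup>*)"

definition delete_vertex :: "'v sgraph \<Rightarrow> 'v \<Rightarrow> 'v sgraph" where
  "delete_vertex G v = (fst G - {v}, snd G \<inter> (fst G - {v}) \<times> (fst G - {v}))"

text \<open>
  Used for connected graphs only. The condition on the vertex set keeps the only vertex
  of a one-vertex graph from being a cut-vertex.
\<close>

definition cut_vertex :: "'v sgraph \<Rightarrow> 'v \<Rightarrow> bool" where
  "cut_vertex G v \<longleftrightarrow>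
     v \<in> fst G \<and> fst G \<noteq> {v} \<and> \<not> connected_graph (delete_vertex G v)"

definition nonseparable :: "'v sgraph \<Rightarrow> bool" where
  "nonseparable G \<longleftrightarrow> connected_graph G \<and> (\<nexists>v. cut_vertex G v)"

definition blocks :: "'v sgraph \<Rightarrow> 'v sgraph set" where
  "blocks G = {H. is_subgraph H G \<and> nonseparable H \<and>
     (\<forall>H'. is_subgraph H' G \<and> nonseparable H' \<and> is_subgraph H H' \<longrightarrow> H' = H)}"

definition complete_bipartite :: "'v set \<Rightarrow> 'v set \<Rightarrow> 'v sgraph" where
  "complete_bipartite X Y = (X \<union> Y, X \<times> Y \<union> Y \<times> X)"

definition bi_block_graph :: "'v sgraph \<Rightarrow> bool" where
  "bi_block_graph G \<longleftrightarrow> simple_graph G \<and> connected_graph G \<and>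
     (\<forall>H\<in>blocks G. \<exists>X Y. X \<noteq> {} \<and> Y \<noteq> {} \<and> X \<inter> Y = {} \<and> H = complete_bipartite X Y)"

text \<open>
  A choice of an enumeration (without repetition) \<open>1, \<dots>, r\<close> of the blocks, together
  with a fixed bipartition of each of them.
\<close>

definition block_bipartitions ::
    "'v sgraph \<Rightarrow> nat \<Rightarrow> (nat \<Rightarrow> 'v set) \<Rightarrow> (nat \<Rightarrow> 'v set) \<Rightarrow> bool" where
  "block_bipartitions G r X Y \<longleftrightarrow>
     (\<forall>k\<in>{1..r}. X k \<noteq> {} \<and> Y k \<noteq> {} \<and> X k \<inter> Y k = {}) \<and>
     bij_betw (\<lambda>k. complete_bipartite (X k) (Y k)) {1..r} (blocks G)"

section \<open>The $q$-distance matrix\<close>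

text \<open>A shortest walk is a path, so the least length of a walk is the path distance.\<close>

definition gdist :: "'v sgraph \<Rightarrow> 'v \<Rightarrow> 'v \<Rightarrow> nat" where
  "gdist G u v = (LEAST n. (u, v) \<in> snd G ^^ n)"

definition q_int :: "'a::comm_ring_1 \<Rightarrow> nat \<Rightarrow> 'a" where
  "q_int q \<alpha> = (\<Sum>i<\<alpha>. q ^ i)"

definition q_distance_matrix :: "'a::comm_ring_1 \<Rightarrow> 'v::finite sgraph \<Rightarrow> 'a^'v^'v" where
  "q_distance_matrix q G = (\<chi> u v. q_int q (gdist G u v))"

section \<open>The data entering the inverse\<close>

definition Delta :: "'a::field \<Rightarrow> (nat \<Rightarrow> 'v set) \<Rightarrow> (nat \<Rightarrow> 'v set) \<Rightarrow> nat \<Rightarrow> 'a" where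
  "Delta q X Y k = q^2 * (of_nat (card (X k)) - 1) * (of_nat (card (Y k)) - 1) - 1"

definition d_hat :: "nat \<Rightarrow> (nat \<Rightarrow> 'v set) \<Rightarrow> (nat \<Rightarrow> 'v set) \<Rightarrow> 'v \<Rightarrow> nat" where
  "d_hat r X Y v = card {k\<in>{1..r}. v \<in> X k \<union> Y k}"

definition x_vec ::
    "'a::field \<Rightarrow> nat \<Rightarrow> (nat \<Rightarrow> 'v::finite set) \<Rightarrow> (nat \<Rightarrow> 'v set) \<Rightarrow> 'a^'v" where
  "x_vec q r X Y = (\<chi> v.
     (\<Sum>k\<in>{k\<in>{1..r}. v \<in> X k}.
        (q * (of_nat (card (Y k)) - 1) - 1) / ((q + 1) * Delta q X Y k)) +
     (\<Sum>k\<in>{k\<in>{1..r}. v \<in> Y k}.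
        (q * (of_nat (card (X k)) - 1) - 1) / ((q + 1) * Delta q X Y k)) -
     (of_nat (d_hat r X Y v) - 1))"

definition y_vec ::
    "'a::field \<Rightarrow> nat \<Rightarrow> (nat \<Rightarrow> 'v::finite set) \<Rightarrow> (nat \<Rightarrow> 'v set) \<Rightarrow> 'a^'v" where
  "y_vec q r X Y = (\<chi> v.
     (\<Sum>k\<in>{k\<in>{1..r}. v \<in> X k}. (of_nat (card (Y k)) - 1) / Delta q X Y k) +
     (\<Sum>k\<in>{k\<in>{1..r}. v \<in> Y k}. (of_nat (card (X k)) - 1) / Delta q X Y k) -
     (of_nat (d_hat r X Y v) - 1))"

text \<open>
  In the next two definitions the index selected by \<open>THE\<close> is unique whenever it exists:
  two distinct blocks have at most one vertex in common.
\<close>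

definition A_mat ::
    "'a::field \<Rightarrow> nat \<Rightarrow> (nat \<Rightarrow> 'v::finite set) \<Rightarrow> (nat \<Rightarrow> 'v set) \<Rightarrow> 'a^'v^'v" where
  "A_mat q r X Y = (\<chi> u v.
     if \<exists>k\<in>{1..r}. (u, v) \<in> snd (complete_bipartite (X k) (Y k))
     then 1 / Delta q X Y (THE k. k \<in> {1..r} \<and> (u, v) \<in> snd (complete_bipartite (X k) (Y k)))
     else 0)"

definition B_mat ::
    "'a::field \<Rightarrow> nat \<Rightarrow> (nat \<Rightarrow> 'v::finite set) \<Rightarrow> (nat \<Rightarrow> 'v set) \<Rightarrow> 'a^'v^'v" where
  "B_mat q r X Y = (\<chi> u v.
     if u \<noteq> v \<and> (\<exists>k\<in>{1..r}. u \<in> X k \<and> v \<in> X k)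
     then (let k = (THE k. k \<in> {1..r} \<and> u \<in> X k \<and> v \<in> X k)
           in (of_nat (card (Y k)) - 1) / Delta q X Y k)
     else if u \<noteq> v \<and> (\<exists>k\<in>{1..r}. u \<in> Y k \<and> v \<in> Y k)
     then (let k = (THE k. k \<in> {1..r} \<and> u \<in> Y k \<and> v \<in> Y k)
           in (of_nat (card (X k)) - 1) / Delta q X Y k)
     else 0)"

definition smult_mat :: "'a::times \<Rightarrow> 'a^'n^'m \<Rightarrow> 'a^'n^'m" (infixr \<open>*\<^sub>m\<close> 75) where
  "c *\<^sub>m M = (\<chi> i j. c * M $ i $ j)"

definition diag_mat :: "'a::zero^'n \<Rightarrow> 'a^'n^'n" where
  "diag_mat w = (\<chi> i j. if i = j then w $ i else 0)"

definition L_mat ::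
    "'a::field \<Rightarrow> nat \<Rightarrow> (nat \<Rightarrow> 'v::finite set) \<Rightarrow> (nat \<Rightarrow> 'v set) \<Rightarrow> 'a^'v^'v" where
  "L_mat q r X Y =
     (q / (q + 1)) *\<^sub>m A_mat q r X Y
     - (q^2 / (q + 1)) *\<^sub>m B_mat q r X Y
     - (q^2 / (q + 1)) *\<^sub>m diag_mat (y_vec q r X Y)
     + (1 / (q + 1)) *\<^sub>m mat 1"

definition lambda_G :: "'a::field \<Rightarrow> nat \<Rightarrow> (nat \<Rightarrow> 'v set) \<Rightarrow> (nat \<Rightarrow> 'v set) \<Rightarrow> 'a" where
  "lambda_G q r X Y = (\<Sum>k=1..r.
     ((q + 1)^2 * (of_nat (card (X k)) - 1) * (of_nat (card (Y k)) - 1)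
        - of_nat (card (X k)) * of_nat (card (Y k)))
     / ((q + 1) * (q^2 * (of_nat (card (X k)) - 1) * (of_nat (card (Y k)) - 1) - 1)))"

end

theory Submission
  imports Defs
begin

text \<open>
  For a block \<open>H\<close> and a vertex \<open>u\<close>, let the gate of \<open>u\<close> be the vertex of \<open>H\<close> in the component of
  \<open>u\<close> after the edges of \<open>H\<close> are removed. Distances from \<open>u\<close> to the vertices of \<open>H\<close> go
  through the gate, and \<open>[a + b] = [a] + q\<^sup>a [b]\<close> reduces row sums over \<open>H\<close> to identities in a
  complete bipartite graph. The matrix \<open>L\<close> and the vector \<open>x\<close> are sums of contributions of the
  blocks, up to a correction by \<open>d_hat v - 1\<close>. This correction cancels because for \<open>u \<noteq> v\<close> the
  vertex \<open>v\<close> is the gate of \<open>u\<close> in all but one of the blocks containing it. The result is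
  \<open>L D + I = x 1\<^sup>T\<close> and \<open>x\<^sup>T D = \<lambda> 1\<^sup>T\<close>, hence \<open>(- L + x x\<^sup>T / \<lambda>) D = I\<close>.
\<close>

section \<open>Blocks and gates\<close>

lemma sym_rtrancl_hub:
  assumes "sym R" and "\<And>u. u \<in> V \<Longrightarrow> (u, c) \<in> R\<^sup>*" and "u \<in> V" "v \<in> V"
  shows "(u, v) \<in> R\<^sup>*"
  using assms by (meson rtrancl_trans sym_rtrancl symD)

lemma sym_snd_delete_vertex: "simple_graph H \<Longrightarrow> sym (snd (delete_vertex H x))"
  by (auto simp: simple_graph_def delete_vertex_def sym_def)

text \<open>Letting \<open>x\<close> range over all vertices removes the side conditions of
  \<open>cut_vertex\<close>: deleting a vertex outside \<open>H\<close> changes nothing, and for a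
  one-vertex graph the condition is vacuous or follows from connectedness.\<close>

lemma nonseparable_iff:
  assumes "simple_graph H"
  shows "nonseparable H \<longleftrightarrow> connected_graph H \<and>
    (\<forall>x. \<forall>u\<in>fst H - {x}. \<forall>v\<in>fst H - {x}. (u, v) \<in> (snd (delete_vertex H x))\<^sup>*)"
    (is "?L \<longleftrightarrow> ?C \<and> ?R")
proof
  assume L: ?L
  have "(u, v) \<in> (snd (delete_vertex H x))\<^sup>*" if "u \<in> fst H - {x}" "v \<in> fst H - {x}" for x u v
  proof (cases "x \<in> fst H")
    case True
    then have "connected_graph (delete_vertex H x)"
      using L that by (auto simp: nonseparable_def cut_vertex_def)
    then show ?thesis
      using that by (auto simp: connected_graph_def delete_vertex_def)
  next
    case False
    then have "delete_vertex H x = H"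
      using assms by (cases H) (auto simp: delete_vertex_def simple_graph_def)
    then show ?thesis
      using L that by (auto simp: nonseparable_def connected_graph_def)
  qed
  then show "?C \<and> ?R" using L by (auto simp: nonseparable_def)
next
  assume R: "?C \<and> ?R"
  have "connected_graph (delete_vertex H v)" if "v \<in> fst H" "fst H \<noteq> {v}" for v
    using R that unfolding connected_graph_def
    by (auto simp: delete_vertex_def)
  then show ?L using R by (auto simp: nonseparable_def cut_vertex_def)
qed

text \<open>Whichever vertex \<open>x\<close> is deleted, one of \<open>a\<close> and
  \<open>b\<close> survives and is a hub to which the rest of both graphs stays connected.\<close>

lemma nonseparable_Un:
  assumes H: "simple_graph H" "nonseparable H" and K: "simple_graph K" "nonseparable K"
    and ab: "a \<in> fst H \<inter> fst K" "b \<in> fst H \<inter> fst K" "a \<noteq> b"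
  shows "simple_graph (fst H \<union> fst K, snd H \<union> snd K)"
    and "nonseparable (fst H \<union> fst K, snd H \<union> snd K)"
proof -
  let ?U = "(fst H \<union> fst K, snd H \<union> snd K)"
  show U: "simple_graph ?U"
    using H(1) K(1) by (auto simp: simple_graph_def sym_def irrefl_def)
  have "(u, v) \<in> (snd ?U)\<^sup>*" if "u \<in> fst ?U" "v \<in> fst ?U" for u v
  proof (rule sym_rtrancl_hub[OF _ _ that])
    show "sym (snd ?U)" using U by (simp add: simple_graph_def)
    fix w assume "w \<in> fst ?U"
    then have "(w, a) \<in> (snd H)\<^sup>* \<or> (w, a) \<in> (snd K)\<^sup>*"
      using ab H(2) K(2) by (auto simp: nonseparable_def connected_graph_def)
    moreover have "(snd H)\<^sup>* \<subseteq> (snd ?U)\<^sup>*" "(snd K)\<^sup>* \<subseteq> (snd ?U)\<^sup>*"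
      by (auto intro!: rtrancl_mono)
    ultimately show "(w, a) \<in> (snd ?U)\<^sup>*" by blast
  qed
  moreover have "(u, v) \<in> (snd (delete_vertex ?U x))\<^sup>*"
    if uv: "u \<in> fst ?U - {x}" "v \<in> fst ?U - {x}" for u v x
  proof -
    obtain c where c: "c \<in> fst H \<inter> fst K" "c \<noteq> x"
      using ab by metis
    show ?thesis
    proof (rule sym_rtrancl_hub[OF _ _ uv])
      show "sym (snd (delete_vertex ?U x))" using U by (rule sym_snd_delete_vertex)
      fix w assume "w \<in> fst ?U - {x}"
      then have "(w, c) \<in> (snd (delete_vertex H x))\<^sup>* \<or> (w, c) \<in> (snd (delete_vertex K x))\<^sup>*"
        using c H(2) K(2) unfolding nonseparable_iff[OF H(1)] nonseparable_iff[OF K(1)] by auto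
      moreover have "(snd (delete_vertex H x))\<^sup>* \<subseteq> (snd (delete_vertex ?U x))\<^sup>*"
        "(snd (delete_vertex K x))\<^sup>* \<subseteq> (snd (delete_vertex ?U x))\<^sup>*"
        by (rule rtrancl_mono, fastforce simp: delete_vertex_def)+
      ultimately show "(w, c) \<in> (snd (delete_vertex ?U x))\<^sup>*" by blast
    qed
  qed
  ultimately show "nonseparable ?U"
    unfolding nonseparable_iff[OF U] using ab by (auto simp: connected_graph_def)
qed

text \<open>The union of the two blocks is nonseparable, so by maximality it equals each of them.
  Hence distinct blocks share at most one vertex.\<close>

lemma block_eqI:
  assumes HK: "H \<in> blocks G" "K \<in> blocks G"
    and ab: "a \<in> fst H" "a \<in> fst K" "b \<in> fst H" "b \<in> fst K" "a \<noteq> b"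
  shows "H = K"
proof -
  let ?U = "(fst H \<union> fst K, snd H \<union> snd K)"
  have s: "is_subgraph H G" "nonseparable H" "is_subgraph K G" "nonseparable K"
    using HK by (auto simp: blocks_def)
  note U = nonseparable_Un[of H K a b]
  have "simple_graph ?U" "nonseparable ?U"
    using U s ab by (auto simp: is_subgraph_def)
  moreover from this have "is_subgraph ?U G" "is_subgraph H ?U" "is_subgraph K ?U"
    using s by (auto simp: is_subgraph_def)
  ultimately have "?U = H" "?U = K"
    using HK unfolding blocks_def by blast+
  then show ?thesis by simp
qed

section \<open>Existence of blocks and their separation property\<close>

lemma finite_subgraphs:
  assumes "simple_graph G"
  shows "finite {H. is_subgraph H G}"
proof (rule finite_subset)
  show "{H. is_subgraph H G} \<subseteq> Pow (fst G) \<times> Pow (snd G)"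
    by (auto simp: is_subgraph_def mem_Times_iff)
  have "finite (snd G)"
    using assms unfolding simple_graph_def by (meson finite_SigmaI finite_subset)
  then show "finite (Pow (fst G) \<times> Pow (snd G))"
    using assms by (simp add: simple_graph_def)
qed

text \<open>Among the finitely many nonseparable subgraphs of \<open>G\<close> containing
  \<open>K\<close>, one with the most vertices and edges in total is maximal, since a proper
  extension increases one of the two counts.\<close>

lemma nonseparable_subset_block:
  assumes "is_subgraph K G" "nonseparable K"
  obtains H where "H \<in> blocks G" "is_subgraph K H"
proof -
  let ?S = "{H. is_subgraph H G \<and> nonseparable H \<and> is_subgraph K H}"
  let ?f = "\<lambda>H. card (fst H) + card (snd H)"
  have "simple_graph G" using assms by (simp add: is_subgraph_def)
  then have "finite {H. is_subgraph H G}" by (rule finite_subgraphs)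
  then have fin: "finite ?S" by (rule rev_finite_subset) auto
  have "K \<in> ?S" using assms by (auto simp: is_subgraph_def)
  then have "Max (?f ` ?S) \<in> ?f ` ?S" using fin by (intro Max_in) blast+
  then obtain H where H: "H \<in> ?S" "Max (?f ` ?S) = ?f H" by blast
  have max: "?f H' \<le> ?f H" if "H' \<in> ?S" for H'
    unfolding H(2)[symmetric] using fin that by (intro Max_ge) auto
  have "H' = H" if H': "is_subgraph H' G" "nonseparable H'" "is_subgraph H H'" for H'
  proof -
    have "?f H' \<le> ?f H"
      using H H' by (intro max) (auto simp: is_subgraph_def)
    moreover have sub: "fst H \<subseteq> fst H'" "snd H \<subseteq> snd H'" "finite (fst H')" "finite (snd H')"
      using H' finite_subset[of "snd H'" "fst H' \<times> fst H'"]
      by (auto simp: is_subgraph_def simple_graph_def)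
    moreover have "card (fst H) \<le> card (fst H')" "card (snd H) \<le> card (snd H')"
      using sub by (auto intro: card_mono)
    ultimately have "card (fst H) = card (fst H')" "card (snd H) = card (snd H')" by linarith+
    then have "fst H = fst H'" "snd H = snd H'"
      using sub by (simp_all add: card_subset_eq)
    then show ?thesis by (simp add: prod_eq_iff)
  qed
  then have "H \<in> blocks G" using H by (auto simp: blocks_def)
  then show thesis using H that by auto
qed

text \<open>A single edge is a nonseparable subgraph, so some block contains it.\<close>

lemma edge_in_block:
  assumes G: "simple_graph G" and e: "(u, v) \<in> snd G"
  obtains H where "H \<in> blocks G" "(u, v) \<in> snd H"
proof -
  let ?K = "({u, v}, {(u, v), (v, u)})"
  have "u \<noteq> v" using G e by (auto simp: simple_graph_def irrefl_def)
  then have sub: "is_subgraph ?K G"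
    using G e by (auto simp: is_subgraph_def simple_graph_def sym_def irrefl_def)
  have "connected_graph ?K"
    by (auto simp: connected_graph_def)
  then have "nonseparable ?K"
    using sub by (subst nonseparable_iff) (auto simp: is_subgraph_def delete_vertex_def)
  from nonseparable_subset_block[OF sub this] obtain H where "H \<in> blocks G" "is_subgraph ?K H" .
  then show thesis using that[of H] by (auto simp: is_subgraph_def)
qed

text \<open>Cutting out the part between two visits to the same vertex would shorten the walk, so a
  walk of least length is injective.\<close>

lemma shortest_walk:
  assumes "(a, b) \<in> R\<^sup>*"
  obtains f :: "nat \<Rightarrow> 'v" and n
  where "f 0 = a" "f n = b" "\<And>i. i < n \<Longrightarrow> (f i, f (Suc i)) \<in> R" "inj_on f {..n}"
proof -
  define n where "n = (LEAST n. (a, b) \<in> R ^^ n)"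
  have "\<exists>n. (a, b) \<in> R ^^ n" using assms by (simp add: rtrancl_power)
  then have n: "(a, b) \<in> R ^^ n" unfolding n_def by (rule LeastI_ex)
  then obtain f where f: "f 0 = a" "f n = b" "\<And>i. i < n \<Longrightarrow> (f i, f (Suc i)) \<in> R"
    by (auto simp: relpow_fun_conv)
  have sub: "(f i, f j) \<in> R ^^ (j - i)" if "i \<le> j" "j \<le> n" for i j
    unfolding relpow_fun_conv using that f by (intro exI[of _ "\<lambda>l. f (l + i)"]) auto
  have "f i \<noteq> f j" if "i < j" "j \<le> n" for i j
  proof
    assume "f i = f j"
    then have "(f 0, f n) \<in> R ^^ (i + (n - j))"
      using sub[of 0 i] sub[of j n] that unfolding relpow_add by auto
    then have "n \<le> i + (n - j)"
      unfolding n_def using f by (intro Least_le) (simp add: n_def)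
    then show False using that by simp
  qed
  then have "inj_on f {..n}"
    by (metis atMost_iff inj_onI linorder_neqE_nat)
  then show thesis using f that by blast
qed

text \<open>If \<open>a \<noteq> b\<close>, adding a shortest such walk to \<open>H\<close> as an ear gives a larger nonseparable
  subgraph.\<close>

lemma block_separates:
  assumes H: "H \<in> blocks G" and ab: "a \<in> fst H" "b \<in> fst H"
    and walk: "(a, b) \<in> (snd G - snd H)\<^sup>*"
  shows "a = b"
proof (rule ccontr)
  assume "a \<noteq> b"
  from shortest_walk[OF walk] obtain f n where f: "f 0 = a" "f n = b"
      "\<And>i. i < n \<Longrightarrow> (f i, f (Suc i)) \<in> snd G - snd H" and inj: "inj_on f {..n}"
    by blast
  have n: "0 < n" using f \<open>a \<noteq> b\<close> by (cases n) auto
  define F where "F = (\<lambda>i. (f i, f (Suc i))) ` {..<n} \<union> (\<lambda>i. (f (Suc i), f i)) ` {..<n}"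
  define K where "K = (fst H \<union> f ` {..n}, snd H \<union> F)"
  have HG: "is_subgraph H G" "nonseparable H" using H by (auto simp: blocks_def)
  then have sH: "simple_graph H" "simple_graph G" by (auto simp: is_subgraph_def)
  have F: "F \<subseteq> snd G" using f(3) sH by (auto simp: F_def simple_graph_def sym_def)
  then have fG: "f ` {..n} \<subseteq> fst G"
  proof -
    have "f i \<in> fst G" if "i \<le> n" for i
    proof (cases "i = n")
      case True
      then show ?thesis using f ab HG by (auto simp: is_subgraph_def)
    next
      case False
      then show ?thesis using f(3)[of i] that sH by (auto simp: simple_graph_def)
    qed
    then show ?thesis by auto
  qed
  have sK: "simple_graph K"
    unfolding simple_graph_def K_def
  proof (intro conjI)
    show "sym (snd (fst H \<union> f ` {..n}, snd H \<union> F))"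
      using sH by (auto simp: simple_graph_def sym_def F_def)
    show "irrefl (snd (fst H \<union> f ` {..n}, snd H \<union> F))"
      using sH F by (auto simp: simple_graph_def irrefl_def)
  qed (use sH in \<open>auto simp: simple_graph_def F_def\<close>)
  have KG: "is_subgraph K G"
    using HG sK F fG by (auto simp: is_subgraph_def K_def)
  have HK: "is_subgraph H K"
    using sH sK by (auto simp: is_subgraph_def K_def)
  \<comment> \<open>The ear can be followed from \<open>f j\<close> towards either end as long as
    the deleted vertex \<open>x\<close> is not met.\<close>
  have left: "(f j, f 0) \<in> (snd (delete_vertex K x))\<^sup>*" if "j \<le> n" "\<forall>i\<le>j. f i \<noteq> x" for j x
    using that
  proof (induction j)
    case (Suc j)
    then have "(f (Suc j), f j) \<in> snd (delete_vertex K x)"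
      by (auto simp: delete_vertex_def K_def F_def)
    then show ?case using Suc by (auto intro: converse_rtrancl_into_rtrancl)
  qed auto
  have right: "(f j, f n) \<in> (snd (delete_vertex K x))\<^sup>*" if "j \<le> n" "\<forall>i\<in>{j..n}. f i \<noteq> x" for j x
    using that
  proof (induction rule: inc_induct)
    case (step j)
    then have "(f j, f (Suc j)) \<in> snd (delete_vertex K x)"
      by (auto simp: delete_vertex_def K_def F_def)
    then show ?case using step by (auto intro: converse_rtrancl_into_rtrancl)
  qed auto
  have to_H: "\<exists>w\<in>fst H - {x}. (u, w) \<in> (snd (delete_vertex K x))\<^sup>*"
    if u: "u \<in> fst K - {x}" for u x
  proof (cases "u \<in> fst H")
    case False
    then obtain j where j: "j \<le> n" "u = f j" using u by (auto simp: K_def)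
    \<comment> \<open>By injectivity \<open>x\<close> occurs at most once on the ear, and not at
      \<open>f j\<close>, so one direction is free and leads to an end in \<open>H\<close> other
      than \<open>x\<close>.\<close>
    have "(\<forall>i\<le>j. f i \<noteq> x) \<or> (\<forall>i\<in>{j..n}. f i \<noteq> x)"
    proof (rule ccontr)
      assume "\<not> ?thesis"
      then obtain i i' where "i \<le> j" "f i = x" "j \<le> i'" "i' \<le> n" "f i' = x" by auto
      then have "i = i'" using inj j by (auto dest: inj_onD)
      then show False using \<open>i \<le> j\<close> \<open>j \<le> i'\<close> \<open>f i = x\<close> u j by auto
    qed
    then show ?thesis using left[of j x] right[of j x] j f ab
      by (metis DiffI atLeastAtMost_iff bot_nat_0.extremum order_refl singletonD)
  qed (use u in auto)
  have H_conn: "\<forall>u\<in>fst H - {x}. \<forall>v\<in>fst H - {x}. (u, v) \<in> (snd (delete_vertex K x))\<^sup>*" for x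
  proof -
    have "snd (delete_vertex H x) \<subseteq> snd (delete_vertex K x)"
      by (auto simp: delete_vertex_def K_def)
    then show ?thesis
      using HG(2) rtrancl_mono unfolding nonseparable_iff[OF sH(1)] by blast
  qed
  have del: "(u, v) \<in> (snd (delete_vertex K x))\<^sup>*" if uv: "u \<in> fst K - {x}" "v \<in> fst K - {x}" for u v x
  proof -
    obtain c where c: "c \<in> fst H - {x}" using to_H uv by blast
    show ?thesis
    proof (rule sym_rtrancl_hub[OF _ _ uv])
      show "(w, c) \<in> (snd (delete_vertex K x))\<^sup>*" if "w \<in> fst K - {x}" for w
        using to_H[OF that] H_conn[of x] c by (meson rtrancl_trans)
    qed (use sK in \<open>rule sym_snd_delete_vertex\<close>)
  qed
  have sndK: "snd (delete_vertex K x) \<subseteq> snd K" for x by (auto simp: delete_vertex_def)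
  \<comment> \<open>Connectedness of \<open>K\<close> follows from the deletion property with
    \<open>x = b\<close>, which links every other vertex to \<open>a\<close>; \<open>b\<close>
    itself is linked to \<open>a\<close> inside \<open>H\<close>.\<close>
  have conn: "(u, v) \<in> (snd K)\<^sup>*" if uv: "u \<in> fst K" "v \<in> fst K" for u v
  proof (rule sym_rtrancl_hub[OF _ _ uv])
    show "sym (snd K)" using sK by (simp add: simple_graph_def)
    have abK: "(a, b) \<in> (snd K)\<^sup>*"
      using HG(2) ab rtrancl_mono[of "snd H" "snd K"]
      by (auto simp: nonseparable_def connected_graph_def K_def)
    have "sym (snd K)" using sK by (simp add: simple_graph_def)
    then have baK: "(b, a) \<in> (snd K)\<^sup>*" using abK by (meson symD sym_rtrancl)
    fix w assume w: "w \<in> fst K"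
    show "(w, a) \<in> (snd K)\<^sup>*"
    proof (cases "w = b")
      case False
      then show ?thesis
        using del[of w b a] w ab \<open>a \<noteq> b\<close> rtrancl_mono[OF sndK] baK
        by (auto simp: K_def)
    qed (use baK in simp)
  qed
  have "nonseparable K"
    unfolding nonseparable_iff[OF sK] using conn del ab by (auto simp: connected_graph_def K_def)
  then have "K = H" using H KG HK unfolding blocks_def by blast
  \<comment> \<open>The first edge of the ear is in \<open>K\<close> but avoids \<open>H\<close>,
    which contradicts \<open>K = H\<close>.\<close>
  moreover have "(f 0, f 1) \<in> snd K" using n by (auto simp: K_def F_def)
  ultimately show False using f(3)[of 0] n by auto
qed

section \<open>Gates of a block\<close>

lemma blockD:
  assumes "H \<in> blocks G"
  shows "simple_graph G" "simple_graph H" "fst H \<subseteq> fst G" "snd H \<subseteq> snd G" "fst H \<noteq> {}"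
  using assms by (auto simp: blocks_def is_subgraph_def nonseparable_def connected_graph_def)

lemma edge_block_unique:
  assumes "H \<in> blocks G" "K \<in> blocks G" "(u, v) \<in> snd H" "(u, v) \<in> snd K"
  shows "H = K"
proof (rule block_eqI[OF assms(1,2)])
  show "u \<in> fst H" "u \<in> fst K" "v \<in> fst H" "v \<in> fst K" "u \<noteq> v"
    using blockD(2)[OF assms(1)] blockD(2)[OF assms(2)] assms(3,4)
    by (auto simp: simple_graph_def irrefl_def)
qed

text \<open>In a connected graph the description is proper: \<open>gate_walk\<close> gives
  existence, and uniqueness is the content of \<open>block_separates\<close>.\<close>

definition gate :: "'v sgraph \<Rightarrow> 'v sgraph \<Rightarrow> 'v \<Rightarrow> 'v" where
  "gate G H u = (THE p. p \<in> fst H \<and> (p, u) \<in> (snd G - snd H)\<^sup>*)"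

lemma gate_eqI:
  assumes H: "H \<in> blocks G" and p: "p \<in> fst H" "(p, u) \<in> (snd G - snd H)\<^sup>*"
  shows "gate G H u = p"
  unfolding gate_def
proof (rule the_equality)
  fix p' assume p': "p' \<in> fst H \<and> (p', u) \<in> (snd G - snd H)\<^sup>*"
  have "sym (snd G - snd H)"
    using blockD[OF H] by (auto simp: simple_graph_def sym_def)
  then have "(u, p) \<in> (snd G - snd H)\<^sup>*" using p(2) by (meson symD sym_rtrancl)
  then show "p' = p" using block_separates[OF H, of p' p] p p' by (meson rtrancl_trans)
qed (use p in simp)

lemma gate_self: "H \<in> blocks G \<Longrightarrow> u \<in> fst H \<Longrightarrow> gate G H u = u"
  by (rule gate_eqI) auto

text \<open>Follow a walk from some vertex of \<open>H\<close> to \<open>u\<close>. Each time it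
  uses an edge of \<open>H\<close>, the endpoint of that edge becomes the new candidate; what
  remains after the last such edge avoids \<open>H\<close>.\<close>

lemma gate_walk:
  assumes G: "connected_graph G" and H: "H \<in> blocks G" and u: "u \<in> fst G"
  shows "gate G H u \<in> fst H" "(gate G H u, u) \<in> (snd G - snd H)\<^sup>*"
proof -
  obtain h where h: "h \<in> fst H" using blockD(5)[OF H] by blast
  then have "(h, u) \<in> (snd G)\<^sup>*" using G u blockD(3)[OF H] by (auto simp: connected_graph_def)
  then have "\<exists>p. p \<in> fst H \<and> (p, u) \<in> (snd G - snd H)\<^sup>*"
  proof induction
    case (step y z)
    show ?case
    proof (cases "(y, z) \<in> snd H")
      case True
      then have "z \<in> fst H" using blockD(2)[OF H] by (auto simp: simple_graph_def)
      then show ?thesis by blast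
    next
      case False
      then show ?thesis using step by (meson DiffI rtrancl_into_rtrancl)
    qed
  qed (use h in blast)
  then show "gate G H u \<in> fst H" "(gate G H u, u) \<in> (snd G - snd H)\<^sup>*"
    using gate_eqI[OF H] by auto
qed

lemma gate_step:
  assumes G: "connected_graph G" and H: "H \<in> blocks G" and e: "(u, v) \<in> snd G - snd H"
  shows "gate G H v = gate G H u"
proof (rule gate_eqI[OF H])
  have "u \<in> fst G" using e blockD(1)[OF H] by (auto simp: simple_graph_def)
  note gate_walk[OF G H this]
  then show "gate G H u \<in> fst H" "(gate G H u, v) \<in> (snd G - snd H)\<^sup>*"
    using e by (auto intro: rtrancl_into_rtrancl simp del: Diff_iff)
qed

text \<open>The gate changes only along an edge of \<open>H\<close>, and the ends of such an edge
  are their own gates. So when the walk leaves the set of vertices with the gate of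
  \<open>w\<close>, it stands at that gate.\<close>

lemma walk_through_gate:
  assumes G: "connected_graph G" and H: "H \<in> blocks G"
    and w: "(w, u) \<in> snd G ^^ n" and ne: "gate G H w \<noteq> gate G H u"
  shows "\<exists>i\<le>n. (w, gate G H w) \<in> snd G ^^ i \<and> (gate G H w, u) \<in> snd G ^^ (n - i)"
  using w ne
proof (induction n arbitrary: u)
  case (Suc n)
  then obtain z where z: "(w, z) \<in> snd G ^^ n" "(z, u) \<in> snd G" by auto
  show ?case
  proof (cases "gate G H w = gate G H z")
    case False
    then obtain i where "i \<le> n" "(w, gate G H w) \<in> snd G ^^ i" "(gate G H w, z) \<in> snd G ^^ (n - i)"
      using Suc z by blast
    then show ?thesis using z(2) by (intro exI[of _ i]) (auto simp: Suc_diff_le)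
  next
    case True
    then have "(z, u) \<in> snd H"
      using gate_step[OF G H, of z u] z(2) Suc.prems by auto
    then have "gate G H z = z" using blockD(2)[OF H] by (intro gate_self[OF H]) (auto simp: simple_graph_def)
    then show ?thesis using True z by (intro exI[of _ n]) (auto simp: Suc_diff_le)
  qed
qed auto

section \<open>Distances through gates\<close>

lemma gdist_le: "(u, v) \<in> snd G ^^ n \<Longrightarrow> gdist G u v \<le> n"
  unfolding gdist_def by (rule Least_le)

lemma gdist_self [simp]: "gdist G u u = 0"
  using gdist_le[of u u 0 G] by simp

lemma sym_relpow:
  assumes "sym R"
  shows "sym (R ^^ n)"
proof (induction n)
  case (Suc n)
  show ?case
  proof (rule symI)
    fix a b assume "(a, b) \<in> R ^^ Suc n"
    then obtain c where "(a, c) \<in> R ^^ n" "(c, b) \<in> R" by (rule relpow_Suc_E)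
    then have "(b, c) \<in> R" "(c, a) \<in> R ^^ n" using assms Suc.IH by (auto dest: symD)
    then show "(b, a) \<in> R ^^ Suc n" by (rule relpow_Suc_I2)
  qed
qed (simp add: sym_Id)

lemma gdist_commute: "sym (snd G) \<Longrightarrow> gdist G u v = gdist G v u"
  unfolding gdist_def by (meson sym_relpow symD)

context
  fixes G :: "'v sgraph"
  assumes conn: "connected_graph G"
begin

lemma gdist_walk:
  assumes "u \<in> fst G" "v \<in> fst G"
  shows "(u, v) \<in> snd G ^^ gdist G u v"
proof -
  have "\<exists>n. (u, v) \<in> snd G ^^ n"
    using conn assms by (auto simp: connected_graph_def rtrancl_power)
  then show ?thesis unfolding gdist_def by (rule LeastI_ex)
qed

lemma gdist_triangle:
  assumes "u \<in> fst G" "v \<in> fst G" "w \<in> fst G"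
  shows "gdist G u w \<le> gdist G u v + gdist G v w"
proof (rule gdist_le)
  show "(u, w) \<in> snd G ^^ (gdist G u v + gdist G v w)"
    unfolding relpow_add using gdist_walk assms by blast
qed

text \<open>Splitting a geodesic at the gate gives the lower bound; the upper bound is the triangle
  inequality.\<close>

lemma gdist_gate:
  assumes H: "H \<in> blocks G" and uw: "u \<in> fst G" "w \<in> fst G" and ne: "gate G H u \<noteq> gate G H w"
  shows "gdist G u w = gdist G u (gate G H u) + gdist G (gate G H u) w"
proof (rule antisym)
  have g: "gate G H u \<in> fst G" using gate_walk(1)[OF conn H uw(1)] blockD(3)[OF H] by blast
  then show "gdist G u w \<le> gdist G u (gate G H u) + gdist G (gate G H u) w"
    using uw by (intro gdist_triangle)
  obtain i where "i \<le> gdist G u w" "(u, gate G H u) \<in> snd G ^^ i"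
      "(gate G H u, w) \<in> snd G ^^ (gdist G u w - i)"
    using walk_through_gate[OF conn H gdist_walk[OF uw] ne] by blast
  then show "gdist G u (gate G H u) + gdist G (gate G H u) w \<le> gdist G u w"
    by (auto dest!: gdist_le)
qed

lemma gdist_block:
  assumes H: "H \<in> blocks G" and u: "u \<in> fst G" and w: "w \<in> fst H"
  shows "gdist G u w = gdist G u (gate G H u) + gdist G (gate G H u) w"
proof (cases "gate G H u = w")
  case False
  then show ?thesis
    using gdist_gate[OF H u, of w] gate_self[OF H w] w blockD(3)[OF H] by auto
qed simp

text \<open>The block is the one containing the first edge of a geodesic from \<open>v\<close> to \<open>u\<close>.\<close>

lemma ex1_block_towards:
  assumes G: "simple_graph G" and uv: "u \<in> fst G" "v \<in> fst G" "u \<noteq> v"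
  shows "\<exists>!H. H \<in> blocks G \<and> v \<in> fst H \<and> gate G H u \<noteq> v"
proof -
  have sym: "sym (snd G)" using G by (simp add: simple_graph_def)
  have walk: "(v, u) \<in> snd G ^^ gdist G v u" using uv by (intro gdist_walk)
  then obtain d where d: "gdist G v u = Suc d"
    using uv by (cases "gdist G v u") auto
  then obtain w where w: "(v, w) \<in> snd G" "(w, u) \<in> snd G ^^ d"
    using walk by (metis relpow_Suc_D2)
  have wG: "w \<in> fst G" using w(1) G by (auto simp: simple_graph_def)
  have closer: "gdist G w u < gdist G v u" using gdist_le[OF w(2)] d by simp
  from edge_in_block[OF G w(1)] obtain H where H: "H \<in> blocks G" "(v, w) \<in> snd H" .
  then have vw: "v \<in> fst H" "w \<in> fst H" using blockD(2)[OF H(1)] by (auto simp: simple_graph_def)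
  show ?thesis
  proof (rule ex1I[of _ H])
    \<comment> \<open>Otherwise the geodesic from \<open>u\<close> to \<open>w\<close> would pass
      through \<open>v\<close>, although \<open>w\<close> is closer to \<open>u\<close>.\<close>
    have "gate G H u \<noteq> v"
      using gdist_block[OF H(1) uv(1) vw(2)] closer gdist_commute[OF sym] by (metis not_add_less1)
    then show "H \<in> blocks G \<and> v \<in> fst H \<and> gate G H u \<noteq> v" using H vw by simp
    fix K assume K: "K \<in> blocks G \<and> v \<in> fst K \<and> gate G K u \<noteq> v"
    have "(v, w) \<in> snd K"
    proof (rule ccontr)
      \<comment> \<open>Then \<open>w\<close> has gate \<open>v\<close> in \<open>K\<close> while
        \<open>u\<close> has another one, so again \<open>v\<close> would lie between
        \<open>w\<close> and \<open>u\<close>.\<close>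
      assume "(v, w) \<notin> snd K"
      then have "gate G K w = v"
        using gate_step[OF conn, of K v w] gate_self[of K G v] K w(1) by auto
      then have "gdist G w u = gdist G w v + gdist G v u"
        using gdist_gate[of K w u] K uv wG by auto
      then show False using closer by simp
    qed
    then show "K = H" using edge_block_unique[of K G H v w] K H by simp
  qed
qed

end

section \<open>Identities in a complete bipartite block\<close>

lemma q_int_add: "q_int q (a + b) = q_int q a + q ^ a * q_int q b"
  by (induction b) (auto simp: q_int_def algebra_simps power_add)

lemma q_int_geometric: "(1 - q) * q_int q a = 1 - q ^ a"
  by (simp add: q_int_def one_diff_power_eq)

lemma sum_of_bool_mem: "(\<Sum>w\<in>(UNIV::'v::finite set). of_bool (w \<in> A) * g w) = (sum g A :: 'a::semiring_1)"
  by (simp add: of_bool_def if_distrib[of "\<lambda>x. x * _"] sum.If_cases cong: if_cong)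

text \<open>The indicators make every sum over the vertices linear in sums over the two sides. The
  summand with \<open>q^2\<close> includes the diagonal \<open>w = v\<close>, where it takes the
  place of \<open>y_vec\<close>; the last summand is the identity restricted to the block.\<close>

definition block_L :: "'a::field \<Rightarrow> 'v set \<Rightarrow> 'v set \<Rightarrow> 'v \<Rightarrow> 'v \<Rightarrow> 'a" where
  "block_L q A B v w =
     (q * (of_bool (v \<in> A) * of_bool (w \<in> B) + of_bool (v \<in> B) * of_bool (w \<in> A))
      - q^2 * ((of_nat (card B) - 1) * of_bool (v \<in> A) * of_bool (w \<in> A)
             + (of_nat (card A) - 1) * of_bool (v \<in> B) * of_bool (w \<in> B)))
     / ((q + 1) * (q^2 * (of_nat (card A) - 1) * (of_nat (card B) - 1) - 1))
     + of_bool (v \<in> A \<union> B) * of_bool (w = v) / (q + 1)"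

definition block_x :: "'a::field \<Rightarrow> 'v set \<Rightarrow> 'v set \<Rightarrow> 'v \<Rightarrow> 'a" where
  "block_x q A B v =
     (of_bool (v \<in> A) * (q * (of_nat (card B) - 1) - 1)
      + of_bool (v \<in> B) * (q * (of_nat (card A) - 1) - 1))
     / ((q + 1) * (q^2 * (of_nat (card A) - 1) * (of_nat (card B) - 1) - 1))"

definition block_lambda :: "'a::field \<Rightarrow> 'v set \<Rightarrow> 'v set \<Rightarrow> 'a" where
  "block_lambda q A B =
     ((q + 1)^2 * (of_nat (card A) - 1) * (of_nat (card B) - 1) - of_nat (card A) * of_nat (card B))
     / ((q + 1) * (q^2 * (of_nat (card A) - 1) * (of_nat (card B) - 1) - 1))"

text \<open>The symmetry in the two sides allows the gate to be placed in the first one.\<close>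

lemma block_commute:
  "block_L q A B = block_L q B A" "block_x q A B = block_x q B A"
  by (auto simp: fun_eq_iff block_L_def block_x_def algebra_simps)

lemma block_lambda_commute: "block_lambda q A B = block_lambda q B A"
  by (simp add: block_lambda_def mult_ac)

lemma sum_block_L:
  fixes g :: "'v::finite \<Rightarrow> 'a::field"
  shows "(\<Sum>w\<in>UNIV. block_L q A B v w * g w) =
     (q * (of_bool (v \<in> A) * sum g B + of_bool (v \<in> B) * sum g A)
      - q^2 * ((of_nat (card B) - 1) * of_bool (v \<in> A) * sum g A
             + (of_nat (card A) - 1) * of_bool (v \<in> B) * sum g B))
     / ((q + 1) * (q^2 * (of_nat (card A) - 1) * (of_nat (card B) - 1) - 1))
     + of_bool (v \<in> A \<union> B) * g v / (q + 1)"
proof -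
  define d where "d = (q + 1) * (q^2 * (of_nat (card A) - 1) * (of_nat (card B) - 1) - 1)"
  have *: "block_L q A B v w * g w =
      (q * of_bool (v \<in> A) / d) * (of_bool (w \<in> B) * g w)
      + (q * of_bool (v \<in> B) / d) * (of_bool (w \<in> A) * g w)
      - (q^2 * (of_nat (card B) - 1) * of_bool (v \<in> A) / d) * (of_bool (w \<in> A) * g w)
      - (q^2 * (of_nat (card A) - 1) * of_bool (v \<in> B) / d) * (of_bool (w \<in> B) * g w)
      + (of_bool (v \<in> A \<union> B) / (q + 1)) * (of_bool (w \<in> {v}) * g w)" for w
    unfolding block_L_def d_def[symmetric]
    unfolding divide_inverse by (simp only: distrib_left distrib_right left_diff_distrib right_diff_distrib ac_simps) simp
  show ?thesis
    unfolding * sum.distrib sum_subtractf sum_distrib_left[symmetric] sum_of_bool_mem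
      d_def[symmetric]
    by (simp add: add_divide_distrib diff_divide_distrib algebra_simps)
qed

lemma sum_block_x:
  fixes g :: "'v::finite \<Rightarrow> 'a::field"
  shows "(\<Sum>w\<in>UNIV. block_x q A B w * g w) =
     ((q * (of_nat (card B) - 1) - 1) * sum g A + (q * (of_nat (card A) - 1) - 1) * sum g B)
     / ((q + 1) * (q^2 * (of_nat (card A) - 1) * (of_nat (card B) - 1) - 1))"
proof -
  define d where "d = (q + 1) * (q^2 * (of_nat (card A) - 1) * (of_nat (card B) - 1) - 1)"
  have *: "block_x q A B w * g w =
      ((q * (of_nat (card B) - 1) - 1) / d) * (of_bool (w \<in> A) * g w)
      + ((q * (of_nat (card A) - 1) - 1) / d) * (of_bool (w \<in> B) * g w)" for w
    unfolding block_x_def d_def[symmetric] divide_inverse by (simp only: distrib_left distrib_right ac_simps)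
  show ?thesis
    unfolding * sum.distrib sum_distrib_left[symmetric] sum_of_bool_mem d_def[symmetric]
    by (simp add: add_divide_distrib)
qed

text \<open>The values \<open>0\<close>, \<open>1\<close> and \<open>1 + q\<close> are the
  q-integers [0], [1] and [2] of the distances in a complete bipartite graph.\<close>

definition block_qdist :: "'a::field \<Rightarrow> 'v set \<Rightarrow> 'v set \<Rightarrow> 'v \<Rightarrow> 'v \<Rightarrow> 'a" where
  "block_qdist q A B p w =
     (if w = p then 0 else if (p \<in> A \<and> w \<in> A) \<or> (p \<in> B \<and> w \<in> B) then 1 + q else 1)"

lemma block_qdist_commute: "block_qdist q A B = block_qdist q B A"
  by (auto simp: block_qdist_def fun_eq_iff)

text \<open>On a block, the q-distances from any vertex have this affine form: \<open>p\<close> is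
  its gate, at distance \<open>a\<close>, with \<open>s\<close> = [a] and \<open>t = q ^ a\<close>.
  The vertex \<open>p\<close> contributes only \<open>s\<close>.\<close>

lemma sum_affine_qdist:
  fixes g :: "'v::finite \<Rightarrow> 'a::field"
  assumes AB: "A \<inter> B = {}" and p: "p \<in> A"
    and g: "\<And>w. w \<in> A \<union> B \<Longrightarrow> g w = s + t * block_qdist q A B p w"
  shows "sum g A = of_nat (card A) * s + t * (1 + q) * (of_nat (card A) - 1)"
    and "sum g B = of_nat (card B) * (s + t)"
proof -
  have "sum g A = g p + sum g (A - {p})" using p by (simp add: sum.remove)
  also have "sum g (A - {p}) = (\<Sum>w\<in>A - {p}. s + t * (1 + q))"
    using p by (intro sum.cong) (auto simp: g block_qdist_def)
  also have "\<dots> = (of_nat (card A) - 1) * (s + t * (1 + q))"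
    using p card_gt_0_iff[of A] by (auto simp: of_nat_diff Suc_leI)
  also have "g p = s" using p by (simp add: g block_qdist_def)
  finally show "sum g A = of_nat (card A) * s + t * (1 + q) * (of_nat (card A) - 1)"
    by (simp add: algebra_simps)
  have "sum g B = (\<Sum>w\<in>B. s + t)"
    using AB p by (intro sum.cong) (auto simp: g block_qdist_def)
  then show "sum g B = of_nat (card B) * (s + t)" by simp
qed

text \<open>Isolates the division, with \<open>c = q + 1\<close> and \<open>d\<close> the value of
  \<open>Delta\<close>, so that a polynomial identity remains.\<close>

lemma combine_fractions:
  fixes c d :: "'a::field"
  assumes "c \<noteq> 0" "d \<noteq> 0" and "N + e * h * d = s * x + t * x - t * \<delta> * (c * d)"
  shows "N / (c * d) + e * h / c = s * (x / (c * d)) + t * (x / (c * d) - \<delta>)"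
proof -
  have "N = s * x + t * x - t * \<delta> * (c * d) - e * h * d"
    using assms(3) by (simp add: algebra_simps)
  then show ?thesis using assms(1,2) by (simp add: field_simps)
qed

lemma combine_fractions':
  fixes c d :: "'a::field"
  assumes "c \<noteq> 0" "d \<noteq> 0" and "N = s * (c * d - e * l) + t * l"
  shows "N / (c * d) = s * (1 - e * (l / (c * d))) + t * (l / (c * d))"
  using assms(1,2) unfolding assms(3) by (simp add: field_simps)

text \<open>The local form of \<open>L D + I = x 1^T\<close>. The coefficient of \<open>s\<close> is
  the action on constants, that of \<open>t\<close> the action on the q-distances from
  \<open>p\<close>.\<close>

lemma block_L_affine:
  fixes g :: "'v::finite \<Rightarrow> 'a::field"
  assumes AB: "A \<inter> B = {}" and p: "p \<in> A \<union> B" and q: "q + 1 \<noteq> 0"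
    and D: "q^2 * (of_nat (card A) - 1) * (of_nat (card B) - 1) - 1 \<noteq> 0"
    and g: "\<And>w. w \<in> A \<union> B \<Longrightarrow> g w = s + t * block_qdist q A B p w"
  shows "(\<Sum>w\<in>UNIV. block_L q A B v w * g w) =
    s * (1 - q) * block_x q A B v + t * (block_x q A B v - of_bool (v = p))"
proof -
  have main: "(\<Sum>w\<in>UNIV. block_L q A B v w * g w) =
      s * (1 - q) * block_x q A B v + t * (block_x q A B v - of_bool (v = p))"
    if AB: "A \<inter> B = {}" and p: "p \<in> A"
      and D: "q^2 * (of_nat (card A) - 1) * (of_nat (card B) - 1) - 1 \<noteq> 0"
      and g: "\<And>w. w \<in> A \<union> B \<Longrightarrow> g w = s + t * block_qdist q A B p w" for A B
  proof -
    have sums: "sum g A = of_nat (card A) * s + t * (1 + q) * (of_nat (card A) - 1)"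
      "sum g B = of_nat (card B) * (s + t)"
      using sum_affine_qdist[OF AB p] g by blast+
    define m n where "m = (of_nat (card A) :: 'a)" and "n = (of_nat (card B) :: 'a)"
    define d where "d = q^2 * (m - 1) * (n - 1) - 1"
    have d: "d \<noteq> 0" using D by (simp add: d_def m_def n_def)
    consider "v \<in> A" "v \<notin> B" | "v \<in> B" "v \<notin> A" | "v \<notin> A \<union> B" using AB by blast
    then show ?thesis
    proof cases
      case 1
      then have gv: "g v = s + t * (1 + q) * (1 - of_bool (v = p))"
        using p by (auto simp: g block_qdist_def)
      then show ?thesis
        unfolding sum_block_L block_x_def sums gv m_def[symmetric] n_def[symmetric] d_def[symmetric]
        using 1 by (intro combine_fractions[OF q d]) (simp add: d_def algebra_simps power2_eq_square)
    next
      case 2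
      then have gv: "g v = s + t" and "v \<noteq> p"
        using p AB by (auto simp: g block_qdist_def)
      then show ?thesis
        unfolding sum_block_L block_x_def sums gv m_def[symmetric] n_def[symmetric] d_def[symmetric]
        using 2 \<open>v \<noteq> p\<close> by (intro combine_fractions[OF q d]) (simp add: d_def algebra_simps power2_eq_square)
    next
      case 3
      then show ?thesis using p unfolding sum_block_L block_x_def by auto
    qed
  qed
  show ?thesis
  proof (cases "p \<in> A")
    case True
    then show ?thesis using main[OF AB True D] g by blast
  next
    case False
    then have "p \<in> B" using p by simp
    moreover have "B \<inter> A = {}" "q^2 * (of_nat (card B) - 1) * (of_nat (card A) - 1) - 1 \<noteq> 0"
      using AB D by (auto simp: mult_ac)
    moreover have "g w = s + t * block_qdist q B A p w" if "w \<in> B \<union> A" for w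
      using g[of w] that by (auto simp: block_qdist_commute[of q A B])
    ultimately show ?thesis
      using main[of B A] unfolding block_commute[of q A B] by blast
  qed
qed

text \<open>The local form of \<open>x^T D = \<lambda> 1^T\<close>: the coefficient of
  \<open>s\<close> is the sum of the entries of \<open>block_x\<close>, that of \<open>t\<close> its
  pairing with the q-distances from \<open>p\<close>.\<close>

lemma block_x_affine:
  fixes g :: "'v::finite \<Rightarrow> 'a::field"
  assumes AB: "A \<inter> B = {}" and p: "p \<in> A \<union> B" and q: "q + 1 \<noteq> 0"
    and D: "q^2 * (of_nat (card A) - 1) * (of_nat (card B) - 1) - 1 \<noteq> 0"
    and g: "\<And>w. w \<in> A \<union> B \<Longrightarrow> g w = s + t * block_qdist q A B p w"
  shows "(\<Sum>w\<in>UNIV. block_x q A B w * g w) =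
    s * (1 - (q - 1) * block_lambda q A B) + t * block_lambda q A B"
proof -
  have main: "(\<Sum>w\<in>UNIV. block_x q A B w * g w) =
      s * (1 - (q - 1) * block_lambda q A B) + t * block_lambda q A B"
    if AB: "A \<inter> B = {}" and p: "p \<in> A"
      and D: "q^2 * (of_nat (card A) - 1) * (of_nat (card B) - 1) - 1 \<noteq> 0"
      and g: "\<And>w. w \<in> A \<union> B \<Longrightarrow> g w = s + t * block_qdist q A B p w" for A B
  proof -
    have sums: "sum g A = of_nat (card A) * s + t * (1 + q) * (of_nat (card A) - 1)"
      "sum g B = of_nat (card B) * (s + t)"
      using sum_affine_qdist[OF AB p] g by blast+
    define m n where "m = (of_nat (card A) :: 'a)" and "n = (of_nat (card B) :: 'a)"
    define d where "d = q^2 * (m - 1) * (n - 1) - 1"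
    have d: "d \<noteq> 0" using D by (simp add: d_def m_def n_def)
    show ?thesis
      unfolding sum_block_x block_lambda_def sums m_def[symmetric] n_def[symmetric] d_def[symmetric]
      by (intro combine_fractions'[OF q d]) (simp add: d_def algebra_simps power2_eq_square)
  qed
  show ?thesis
  proof (cases "p \<in> A")
    case True
    then show ?thesis using main[OF AB True D] g by blast
  next
    case False
    then have "p \<in> B" using p by simp
    moreover have "B \<inter> A = {}" "q^2 * (of_nat (card B) - 1) * (of_nat (card A) - 1) - 1 \<noteq> 0"
      using AB D by (auto simp: mult_ac)
    moreover have "g w = s + t * block_qdist q B A p w" if "w \<in> B \<union> A" for w
      using g[of w] that by (auto simp: block_qdist_commute[of q A B])
    ultimately show ?thesis
      using main[of B A] unfolding block_commute(2)[of q A B] block_lambda_commute[of q A B] by blast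
  qed
qed

section \<open>The inverse of the distance matrix\<close>

text \<open>Turns the \<open>THE\<close> in \<open>A_mat\<close> and \<open>B_mat\<close> into a sum
  over all blocks with at most one nonzero term.\<close>

lemma sum_unique_index:
  fixes f :: "'i \<Rightarrow> 'a::comm_monoid_add"
  assumes "finite I" and uniq: "\<And>k l. k \<in> I \<Longrightarrow> l \<in> I \<Longrightarrow> P k \<Longrightarrow> P l \<Longrightarrow> k = l"
  shows "(\<Sum>k\<in>I. if P k then f k else 0) = (if \<exists>k\<in>I. P k then f (THE k. k \<in> I \<and> P k) else 0)"
proof (cases "\<exists>k\<in>I. P k")
  case True
  then obtain k where k: "k \<in> I" "P k" by blast
  then have "(THE k. k \<in> I \<and> P k) = k" using uniq by blast
  moreover have "(\<Sum>l\<in>I. if P l then f l else 0) = (\<Sum>l\<in>{k}. if P l then f l else 0)"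
    using assms k by (intro sum.mono_neutral_right) auto
  ultimately show ?thesis using k True by simp
qed simp

lemma sum_filter_of_bool:
  fixes f :: "'i \<Rightarrow> 'a::semiring_1"
  shows "finite I \<Longrightarrow> (\<Sum>k\<in>{k\<in>I. P k}. f k) = (\<Sum>k\<in>I. of_bool (P k) * f k)"
  unfolding sum.inter_filter by (intro sum.cong) auto

section \<open>Distances and gates for the enumerated blocks\<close>

locale bi_block =
  fixes G :: "'v::finite sgraph" and r :: nat and X Y :: "nat \<Rightarrow> 'v set"
  assumes bi_block: "bi_block_graph G" and bip: "block_bipartitions G r X Y"
    and vertices: "fst G = UNIV"
begin

abbreviation Bl :: "nat \<Rightarrow> 'v sgraph" where
  "Bl k \<equiv> complete_bipartite (X k) (Y k)"

abbreviation pr :: "nat \<Rightarrow> 'v \<Rightarrow> 'v" where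
  "pr k u \<equiv> gate G (Bl k) u"

lemma G: "simple_graph G" "connected_graph G" "sym (snd G)"
  using bi_block by (auto simp: bi_block_graph_def simple_graph_def)

lemma fst_Bl: "fst (Bl k) = X k \<union> Y k"
  by (simp add: complete_bipartite_def)

lemma Bl_block: "k \<in> {1..r} \<Longrightarrow> Bl k \<in> blocks G"
  using bip by (auto simp: block_bipartitions_def bij_betw_def)

lemma disjoint: "k \<in> {1..r} \<Longrightarrow> X k \<inter> Y k = {}"
  using bip by (auto simp: block_bipartitions_def)

lemma Bl_eqD: "k \<in> {1..r} \<Longrightarrow> l \<in> {1..r} \<Longrightarrow> Bl k = Bl l \<Longrightarrow> k = l"
  using bip by (auto simp: block_bipartitions_def bij_betw_def dest: inj_onD)

lemma block_indexE:
  assumes "H \<in> blocks G"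
  obtains k where "k \<in> {1..r}" "H = Bl k"
proof -
  have "H \<in> (\<lambda>k. Bl k) ` {1..r}"
    using assms bip by (simp add: block_bipartitions_def bij_betw_def)
  then show thesis using that by blast
qed

lemma index_eqI:
  assumes "k \<in> {1..r}" "l \<in> {1..r}" and "u \<noteq> v"
    and "u \<in> X k \<union> Y k" "v \<in> X k \<union> Y k" "u \<in> X l \<union> Y l" "v \<in> X l \<union> Y l"
  shows "k = l"
  using Bl_eqD[OF assms(1,2)] block_eqI[OF Bl_block[OF assms(1)] Bl_block[OF assms(2)], of u v] assms
  by (simp add: fst_Bl)

lemma pr_mem: "k \<in> {1..r} \<Longrightarrow> pr k u \<in> X k \<union> Y k"
  using gate_walk(1)[OF G(2) Bl_block, of k u] by (simp add: vertices fst_Bl)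

lemma gdist_pr:
  "k \<in> {1..r} \<Longrightarrow> w \<in> X k \<union> Y k \<Longrightarrow> gdist G u w = gdist G u (pr k u) + gdist G (pr k u) w"
  using gdist_block[OF G(2) Bl_block, of k u w] by (simp add: vertices fst_Bl)

text \<open>The distance is taken in all of \<open>G\<close>. Two vertices on the same side are not
  adjacent, since the block of such an edge would have to be this one, whose sides are disjoint; a
  vertex of the other side gives distance 2.\<close>

lemma gdist_in_block:
  assumes k: "k \<in> {1..r}" and uv: "u \<in> X k \<union> Y k" "v \<in> X k \<union> Y k"
  shows "gdist G u v =
    (if v = u then 0 else if (u \<in> X k \<and> v \<in> X k) \<or> (u \<in> Y k \<and> v \<in> Y k) then 2 else 1)"
proof (cases "v = u")
  case False
  have E: "snd (Bl k) \<subseteq> snd G" using blockD(4)[OF Bl_block[OF k]] .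
  have walk: "(u, v) \<in> snd G ^^ gdist G u v"
    by (rule gdist_walk[OF G(2)]) (simp_all add: vertices)
  then have "gdist G u v \<noteq> 0" using False by (cases "gdist G u v") auto
  show ?thesis
  proof (cases "(u \<in> X k \<and> v \<in> X k) \<or> (u \<in> Y k \<and> v \<in> Y k)")
    case True
    have "gdist G u v \<noteq> 1"
    proof
      assume "gdist G u v = 1"
      then have "(u, v) \<in> snd G" using walk by simp
      from edge_in_block[OF G(1) this] obtain H where H: "H \<in> blocks G" "(u, v) \<in> snd H" .
      from block_indexE[OF H(1)] obtain l where l: "l \<in> {1..r}" "H = Bl l" .
      have "u \<in> X l \<union> Y l" "v \<in> X l \<union> Y l" using H(2) l by (auto simp: complete_bipartite_def)
      then have "l = k" using index_eqI[OF l(1) k, of u v] uv False by auto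
      then show False using H(2) l True disjoint[OF k] by (auto simp: complete_bipartite_def)
    qed
    moreover have "X k \<noteq> {}" "Y k \<noteq> {}"
      using bip k by (auto simp: block_bipartitions_def)
    then obtain w where "(u, w) \<in> snd (Bl k)" "(w, v) \<in> snd (Bl k)"
      using True unfolding complete_bipartite_def snd_conv by blast
    then have "(u, v) \<in> snd G ^^ 2" using E by (auto simp: numeral_2_eq_2)
    then have "gdist G u v \<le> 2" by (rule gdist_le)
    ultimately show ?thesis using \<open>gdist G u v \<noteq> 0\<close> True False by auto
  next
    case other: False
    then have "(u, v) \<in> snd (Bl k)" using uv by (auto simp: complete_bipartite_def)
    then have "(u, v) \<in> snd G ^^ 1" using E by auto
    then have "gdist G u v \<le> 1" by (rule gdist_le)
    then show ?thesis using \<open>gdist G u v \<noteq> 0\<close> other False by auto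
  qed
qed simp

lemma q_int_gdist:
  fixes q :: "'a::field"
  assumes k: "k \<in> {1..r}" and w: "w \<in> X k \<union> Y k"
  shows "q_int q (gdist G u w) = q_int q (gdist G u (pr k u))
    + q ^ gdist G u (pr k u) * block_qdist q (X k) (Y k) (pr k u) w"
proof -
  have "q_int q (gdist G (pr k u) w) = block_qdist q (X k) (Y k) (pr k u) w"
    unfolding gdist_in_block[OF k pr_mem[OF k] w] block_qdist_def
    by (simp add: q_int_def numeral_2_eq_2)
  then show ?thesis
    unfolding gdist_pr[OF k w, of u] q_int_add by simp
qed

text \<open>A block with gate \<open>v\<close> contains \<open>v\<close>. If \<open>v = u\<close>,
  all blocks containing \<open>v\<close> count; otherwise all except the one leading from
  \<open>v\<close> towards \<open>u\<close>. This is the origin of the term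
  \<open>d_hat v - 1\<close>.\<close>

lemma card_pr_eq:
  "of_nat (card {k \<in> {1..r}. pr k u = v}) = of_nat (d_hat r X Y v) - 1 + (of_bool (v = u) :: 'a::ring_1)"
proof (cases "v = u")
  case True
  have "{k \<in> {1..r}. pr k u = u} = {k \<in> {1..r}. u \<in> X k \<union> Y k}"
    using pr_mem[of _ u] gate_self[OF Bl_block, of _ u] by (auto simp: fst_Bl) metis+
  then show ?thesis using True by (simp add: d_hat_def)
next
  case False
  let ?S = "{k \<in> {1..r}. v \<in> X k \<union> Y k}"
  have "\<exists>!H. H \<in> blocks G \<and> v \<in> fst H \<and> gate G H u \<noteq> v"
    using ex1_block_towards[OF G(2,1), of u v] False vertices by auto
  then obtain H where H: "H \<in> blocks G" "v \<in> fst H" "gate G H u \<noteq> v"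
    and uniq: "\<And>K. K \<in> blocks G \<Longrightarrow> v \<in> fst K \<Longrightarrow> gate G K u \<noteq> v \<Longrightarrow> K = H"
    by blast
  from block_indexE[OF H(1)] obtain l where l: "l \<in> {1..r}" "H = Bl l" .
  have "k = l" if "k \<in> ?S" "pr k u \<noteq> v" for k
  proof -
    have k: "k \<in> {1..r}" "v \<in> fst (Bl k)" using that(1) by (simp_all add: fst_Bl)
    then show ?thesis
      using Bl_eqD[OF k(1) l(1)] uniq[OF Bl_block[OF k(1)] k(2) that(2)] l(2) by simp
  qed
  moreover have "v \<in> X k \<union> Y k" if "k \<in> {1..r}" "pr k u = v" for k
    using pr_mem[OF that(1), of u] that by simp
  ultimately have "{k \<in> {1..r}. pr k u = v} = ?S - {l}"
    using H(3) l by blast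
  moreover have "l \<in> ?S" using H(2) l by (simp add: fst_Bl)
  moreover from this have "card ?S > 0" by (auto simp: card_gt_0_iff)
  ultimately show ?thesis using False by (simp add: d_hat_def of_nat_diff Suc_leI)
qed

section \<open>Decomposition of the vector and the matrices over the blocks\<close>

context
  fixes q :: "'a::field"
begin

lemma Delta_eq: "q^2 * (of_nat (card (X k)) - 1) * (of_nat (card (Y k)) - 1) - 1 = Delta q X Y k"
  by (simp add: Delta_def)

lemma x_vec_eq:
  "x_vec q r X Y $ v = (\<Sum>k=1..r. block_x q (X k) (Y k) v) - (of_nat (d_hat r X Y v) - 1)"
  unfolding x_vec_def block_x_def Delta_eq
  by (simp add: sum_filter_of_bool[OF finite_atLeastAtMost] sum.distrib[symmetric] add_divide_distrib
      del: atLeastAtMost_iff)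

lemma A_mat_eq:
  "A_mat q r X Y $ v $ w =
    (\<Sum>k=1..r. (of_bool (v \<in> X k) * of_bool (w \<in> Y k) + of_bool (v \<in> Y k) * of_bool (w \<in> X k))
       / Delta q X Y k)"
proof -
  have "A_mat q r X Y $ v $ w = (\<Sum>k=1..r. if (v, w) \<in> snd (Bl k) then 1 / Delta q X Y k else 0)"
    unfolding A_mat_def vec_lambda_beta
  proof (rule sum_unique_index[symmetric])
    show "k = l" if "k \<in> {1..r}" "l \<in> {1..r}" "(v, w) \<in> snd (Bl k)" "(v, w) \<in> snd (Bl l)" for k l
      using edge_block_unique[OF Bl_block Bl_block] Bl_eqD that by blast
  qed simp
  also have "\<dots> = (\<Sum>k=1..r. (of_bool (v \<in> X k) * of_bool (w \<in> Y k)
      + of_bool (v \<in> Y k) * of_bool (w \<in> X k)) / Delta q X Y k)"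
    using disjoint by (intro sum.cong) (auto simp: complete_bipartite_def of_bool_def)
  finally show ?thesis .
qed

text \<open>\<open>B_mat\<close> vanishes on the diagonal, and \<open>y_vec\<close> supplies just
  the missing diagonal terms of the block sum, up to the correction.\<close>

lemma B_mat_eq:
  "B_mat q r X Y $ v $ w + diag_mat (y_vec q r X Y) $ v $ w =
    (\<Sum>k=1..r. ((of_nat (card (Y k)) - 1) * of_bool (v \<in> X k) * of_bool (w \<in> X k)
       + (of_nat (card (X k)) - 1) * of_bool (v \<in> Y k) * of_bool (w \<in> Y k)) / Delta q X Y k)
    - of_bool (w = v) * (of_nat (d_hat r X Y v) - 1)"
proof (cases "v = w")
  case True
  have [simp]: "of_bool b * (of_bool b * c) = of_bool b * c" for b and c :: 'a
    by simp
  show ?thesis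
    using True unfolding B_mat_def diag_mat_def y_vec_def
    by (simp add: sum_filter_of_bool[OF finite_atLeastAtMost] sum.distrib[symmetric] add_divide_distrib
      mult_ac del: atLeastAtMost_iff of_bool_conj)
next
  case False
  let ?f = "\<lambda>k. (of_nat (card (Y k)) - 1) / Delta q X Y k"
  let ?g = "\<lambda>k. (of_nat (card (X k)) - 1) / Delta q X Y k"
  have X: "(\<Sum>k=1..r. if v \<in> X k \<and> w \<in> X k then ?f k else 0) =
      (if \<exists>k\<in>{1..r}. v \<in> X k \<and> w \<in> X k then ?f (THE k. k \<in> {1..r} \<and> v \<in> X k \<and> w \<in> X k) else 0)"
    by (rule sum_unique_index) (simp, use index_eqI[of _ _ v w] False in blast)
  have Y: "(\<Sum>k=1..r. if v \<in> Y k \<and> w \<in> Y k then ?g k else 0) =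
      (if \<exists>k\<in>{1..r}. v \<in> Y k \<and> w \<in> Y k then ?g (THE k. k \<in> {1..r} \<and> v \<in> Y k \<and> w \<in> Y k) else 0)"
    by (rule sum_unique_index) (simp, use index_eqI[of _ _ v w] False in blast)
  \<comment> \<open>The nested conditionals of \<open>B_mat\<close> lose no summand, because the two
    cases cannot occur together.\<close>
  have excl: False if "k \<in> {1..r}" "v \<in> X k" "w \<in> X k" "l \<in> {1..r}" "v \<in> Y l" "w \<in> Y l" for k l
    using index_eqI[of k l v w] that False disjoint[of k] by auto
  have "B_mat q r X Y $ v $ w = (\<Sum>k=1..r. if v \<in> X k \<and> w \<in> X k then ?f k else 0)
      + (\<Sum>k=1..r. if v \<in> Y k \<and> w \<in> Y k then ?g k else 0)"
  proof (cases "\<exists>k\<in>{1..r}. v \<in> X k \<and> w \<in> X k")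
    case True
    then have noY: "\<not> (\<exists>k\<in>{1..r}. v \<in> Y k \<and> w \<in> Y k)" using excl by blast
    show ?thesis
      unfolding B_mat_def vec_lambda_beta X Y Let_def
      by (simp only: False True noY simp_thms if_True if_False add_0_right)
  next
    case notX: False
    show ?thesis
      unfolding B_mat_def vec_lambda_beta X Y Let_def
      by (simp only: False notX simp_thms if_True if_False add_0_left)
  qed
  also have "\<dots> = (\<Sum>k=1..r. ((of_nat (card (Y k)) - 1) * of_bool (v \<in> X k) * of_bool (w \<in> X k)
       + (of_nat (card (X k)) - 1) * of_bool (v \<in> Y k) * of_bool (w \<in> Y k)) / Delta q X Y k)"
    unfolding sum.distrib[symmetric] by (intro sum.cong) (auto simp: add_divide_distrib of_bool_def)
  finally show ?thesis using False by (simp add: diag_mat_def)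
qed

text \<open>On the diagonal the blocks contribute \<open>1 / (q + 1)\<close> in total
  \<open>d_hat v\<close> times instead of once, and \<open>y_vec\<close> brings
  \<open>q^2 / (q + 1)\<close> times \<open>d_hat v - 1\<close>. The net factor is
  \<open>(q^2 - 1) / (q + 1) = q - 1\<close>.\<close>

lemma L_mat_eq:
  assumes q: "q + 1 \<noteq> 0"
  shows "L_mat q r X Y $ v $ w =
    (\<Sum>k=1..r. block_L q (X k) (Y k) v w) + (q - 1) * (of_nat (d_hat r X Y v) - 1) * of_bool (w = v)"
proof -
  define e f h where "e = q^2 / (q + 1)" and "f = 1 / (q + 1)" and "h = q / (q + 1)"
  define a where "a k = (of_bool (v \<in> X k) * of_bool (w \<in> Y k) + of_bool (v \<in> Y k) * of_bool (w \<in> X k))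
      / Delta q X Y k" for k
  define b where "b k = ((of_nat (card (Y k)) - 1) * of_bool (v \<in> X k) * of_bool (w \<in> X k)
      + (of_nat (card (X k)) - 1) * of_bool (v \<in> Y k) * of_bool (w \<in> Y k)) / Delta q X Y k" for k
  define dh where "dh = (of_nat (d_hat r X Y v) :: 'a)"
  have "block_L q (X k) (Y k) v w = h * a k - e * b k
      + f * of_bool (w = v) * of_bool (v \<in> X k \<union> Y k)" for k
    unfolding block_L_def Delta_eq a_def b_def e_def f_def h_def divide_inverse inverse_mult_distrib
    by (simp only: mult_1_left distrib_left distrib_right left_diff_distrib right_diff_distrib ac_simps)
  moreover have "(\<Sum>k=1..r. of_bool (v \<in> X k \<union> Y k)) = dh"
    by (simp add: dh_def d_hat_def sum.If_cases of_bool_def Int_def cong: if_cong del: Un_iff)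
  ultimately have blocks: "(\<Sum>k=1..r. block_L q (X k) (Y k) v w) =
      h * sum a {1..r} - e * sum b {1..r} + f * of_bool (w = v) * dh"
    by (simp only: sum.distrib sum_subtractf sum_distrib_left[symmetric])
  have "L_mat q r X Y $ v $ w = h * A_mat q r X Y $ v $ w
      - e * (B_mat q r X Y $ v $ w + diag_mat (y_vec q r X Y) $ v $ w) + f * of_bool (w = v)"
    unfolding L_mat_def smult_mat_def mat_def e_def[symmetric] f_def[symmetric] h_def[symmetric]
    by (simp add: algebra_simps)
  also have "\<dots> = h * sum a {1..r} - e * (sum b {1..r} - of_bool (w = v) * (dh - 1))
      + f * of_bool (w = v)"
    unfolding A_mat_eq B_mat_eq a_def b_def dh_def ..
  also have "\<dots> = (\<Sum>k=1..r. block_L q (X k) (Y k) v w) + (q - 1) * (dh - 1) * of_bool (w = v)"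
  proof -
    have e: "e = f + q - 1" using q by (simp add: e_def f_def field_simps power2_eq_square)
    show ?thesis unfolding blocks e by (simp add: algebra_simps)
  qed
  finally show ?thesis by (simp add: dh_def)
qed

section \<open>Pairing with the q-distances\<close>

context
  assumes q: "q + 1 \<noteq> 0" and D: "\<And>k. k \<in> {1..r} \<Longrightarrow> Delta q X Y k \<noteq> 0"
begin

text \<open>By \<open>card_pr_eq\<close> the block terms leave
  \<open>- q ^ gdist G u v * (d_hat v - 1)\<close> besides the indicator of \<open>v = u\<close>.
  The diagonal correction of \<open>L_mat\<close> turns this power into 1, which completes
  \<open>x_vec\<close>.\<close>

lemma L_mat_qdist:
  "(\<Sum>w\<in>UNIV. L_mat q r X Y $ v $ w * q_int q (gdist G u w)) = x_vec q r X Y $ v - of_bool (v = u)"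
proof -
  let ?d = "of_nat (d_hat r X Y v) - 1 :: 'a"
  let ?g = "\<lambda>w. q_int q (gdist G u w)"
  have "(\<Sum>w\<in>UNIV. block_L q (X k) (Y k) v w * ?g w) =
      block_x q (X k) (Y k) v - q ^ gdist G u v * of_bool (pr k u = v)" if k: "k \<in> {1..r}" for k
  proof -
    let ?e = "gdist G u (pr k u)" and ?x = "block_x q (X k) (Y k) v"
    have "(\<Sum>w\<in>UNIV. block_L q (X k) (Y k) v w * ?g w) =
        q_int q ?e * (1 - q) * ?x + q ^ ?e * (?x - of_bool (v = pr k u))"
      using disjoint[OF k] pr_mem[OF k] q D[OF k] unfolding Delta_eq[symmetric]
      by (rule block_L_affine) (rule q_int_gdist[OF k])
    also have "q_int q ?e * (1 - q) = 1 - q ^ ?e"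
      using q_int_geometric[of q ?e] by (simp add: mult.commute)
    \<comment> \<open>The coefficients of \<open>?x\<close> add up to 1. Where the indicator is
      nonzero the gate is \<open>v\<close>, so the exponent no longer depends on
      \<open>k\<close>.\<close>
    finally show ?thesis by (auto simp: algebra_simps)
  qed
  then have "(\<Sum>k=1..r. \<Sum>w\<in>UNIV. block_L q (X k) (Y k) v w * ?g w) =
      (\<Sum>k=1..r. block_x q (X k) (Y k) v) - q ^ gdist G u v * (\<Sum>k=1..r. of_bool (pr k u = v))"
    by (simp add: sum_subtractf sum_distrib_left)
  also have "(\<Sum>k=1..r. of_bool (pr k u = v)) = ?d + of_bool (v = u)"
    unfolding card_pr_eq[symmetric] by (simp add: sum.If_cases of_bool_def Int_def cong: if_cong)
  finally have blocks: "(\<Sum>w\<in>UNIV. (\<Sum>k=1..r. block_L q (X k) (Y k) v w) * ?g w) =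
      (\<Sum>k=1..r. block_x q (X k) (Y k) v) - q ^ gdist G u v * (?d + of_bool (v = u))"
    unfolding sum_distrib_right by (subst sum.swap)
  have "(\<Sum>w\<in>UNIV. L_mat q r X Y $ v $ w * ?g w) =
      (\<Sum>w\<in>UNIV. (\<Sum>k=1..r. block_L q (X k) (Y k) v w) * ?g w)
      + (\<Sum>w\<in>UNIV. of_bool (w \<in> {v}) * ((q - 1) * ?d * ?g w))"
    unfolding L_mat_eq[OF q] sum.distrib[symmetric] by (intro sum.cong) (auto simp: algebra_simps)
  also have "\<dots> = (\<Sum>k=1..r. block_x q (X k) (Y k) v) - q ^ gdist G u v * (?d + of_bool (v = u))
      - ?d * ((1 - q) * ?g v)"
    unfolding blocks sum_of_bool_mem by (simp add: algebra_simps)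
  also have "\<dots> = x_vec q r X Y $ v - q ^ gdist G u v * of_bool (v = u)"
    unfolding x_vec_eq q_int_geometric by (simp add: algebra_simps)
  also have "\<dots> = x_vec q r X Y $ v - of_bool (v = u)" by auto
  finally show ?thesis .
qed

text \<open>Each block yields its share of \<open>lambda_G\<close> plus the q-distance from
  \<open>u\<close> to its gate. Grouped by gates, the latter cancel the correction in
  \<open>x_vec\<close>.\<close>

lemma x_vec_qdist: "(\<Sum>w\<in>UNIV. x_vec q r X Y $ w * q_int q (gdist G u w)) = lambda_G q r X Y"
proof -
  let ?d = "\<lambda>w. of_nat (d_hat r X Y w) - 1 :: 'a"
  let ?g = "\<lambda>w. q_int q (gdist G u w)"
  have lambda: "lambda_G q r X Y = (\<Sum>k=1..r. block_lambda q (X k) (Y k))"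
    by (simp add: lambda_G_def block_lambda_def)
  have "(\<Sum>w\<in>UNIV. block_x q (X k) (Y k) w * ?g w) =
      block_lambda q (X k) (Y k) + ?g (pr k u)" if k: "k \<in> {1..r}" for k
  proof -
    let ?e = "gdist G u (pr k u)" and ?l = "block_lambda q (X k) (Y k)"
    have "(\<Sum>w\<in>UNIV. block_x q (X k) (Y k) w * ?g w) =
        q_int q ?e * (1 - (q - 1) * ?l) + q ^ ?e * ?l"
      using disjoint[OF k] pr_mem[OF k] q D[OF k] unfolding Delta_eq[symmetric]
      by (rule block_x_affine) (rule q_int_gdist[OF k])
    also have "\<dots> = ?g (pr k u) + ((1 - q) * q_int q ?e + q ^ ?e) * ?l"
      by (simp add: algebra_simps)
    finally show ?thesis by (simp add: q_int_geometric)
  qed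
  then have "(\<Sum>k=1..r. \<Sum>w\<in>UNIV. block_x q (X k) (Y k) w * ?g w) =
      lambda_G q r X Y + (\<Sum>k=1..r. ?g (pr k u))"
    by (simp add: sum.distrib lambda)
  also have "(\<Sum>k=1..r. ?g (pr k u)) = (\<Sum>w\<in>UNIV. \<Sum>k | k \<in> {1..r} \<and> pr k u = w. ?g (pr k u))"
    by (rule sum.group[symmetric]) auto
  also have "\<dots> = (\<Sum>w\<in>UNIV. ?d w * ?g w)"
  proof (rule sum.cong[OF refl])
    fix w
    have "(\<Sum>k | k \<in> {1..r} \<and> pr k u = w. ?g (pr k u)) = of_nat (card {k \<in> {1..r}. pr k u = w}) * ?g w"
      by simp
    \<comment> \<open>The extra 1 in the count at \<open>w = u\<close> is multiplied by
      \<open>q_int q 0 = 0\<close>.\<close>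
    also have "\<dots> = ?d w * ?g w"
      unfolding card_pr_eq by (auto simp: q_int_def)
    finally show "(\<Sum>k | k \<in> {1..r} \<and> pr k u = w. ?g (pr k u)) = ?d w * ?g w" .
  qed
  finally have "(\<Sum>w\<in>UNIV. (\<Sum>k=1..r. block_x q (X k) (Y k) w) * ?g w) =
      lambda_G q r X Y + (\<Sum>w\<in>UNIV. ?d w * ?g w)"
    unfolding sum_distrib_right by (subst sum.swap)
  then show ?thesis
    unfolding x_vec_eq left_diff_distrib sum_subtractf by (simp add: sum_subtractf left_diff_distrib)
qed

end

end

end

section \<open>Assembly of the inverse\<close>

lemma matrix_mult_nth: "(A ** B) $ i $ j = (\<Sum>k\<in>UNIV. A $ i $ k * B $ k $ j)"
  by (simp add: matrix_matrix_mult_def)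

theorem theorem5p9:
  fixes E :: "'v::finite rel"
    and X Y :: "nat \<Rightarrow> 'v set"
    and m n :: "nat \<Rightarrow> nat"
    and r :: nat
    and q :: "'a::field_char_0"
  defines "G \<equiv> (UNIV, E)"
  assumes "bi_block_graph G"
    and "block_bipartitions G r X Y"
    and "\<And>k. k \<in> {1..r} \<Longrightarrow> m k = card (X k)"
    and "\<And>k. k \<in> {1..r} \<Longrightarrow> n k = card (Y k)"
    and "int CARD('v) = (\<Sum>k=1..r. int (m k + n k)) - int r + 1"
    and "r > 1"
    and "q \<noteq> -1"
    and "\<And>k. k \<in> {1..r} \<Longrightarrow> q^2 * (of_nat (m k) - 1) * (of_nat (n k) - 1) \<noteq> 1"
    and "\<And>k. k \<in> {1..r} \<Longrightarrow>
           (q + 1)^2 * (of_nat (m k) - 1) * (of_nat (n k) - 1) \<noteq> of_nat (m k) * of_nat (n k)"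
    and "lambda_G q r X Y \<noteq> 0"
  shows "invertible (q_distance_matrix q G) \<and>
         matrix_inv (q_distance_matrix q G) =
           - L_mat q r X Y
           + (1 / lambda_G q r X Y) *\<^sub>m
               ((columnvector (x_vec q r X Y) :: 'a^1^'v) ** rowvector (x_vec q r X Y))"
proof -
  interpret bi_block G r X Y
    using assms by unfold_locales (auto simp: G_def)
  let ?D = "q_distance_matrix q G" and ?x = "x_vec q r X Y" and ?l = "lambda_G q r X Y"
  let ?M = "- L_mat q r X Y + (1 / ?l) *\<^sub>m ((columnvector ?x :: 'a^1^'v) ** rowvector ?x)"
  have q: "q + 1 \<noteq> 0" using assms(8) by (simp add: eq_neg_iff_add_eq_0)
  have D: "Delta q X Y k \<noteq> 0" if "k \<in> {1..r}" for k
    using assms(9)[OF that] assms(4,5)[OF that] by (simp add: Delta_def)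
  \<comment> \<open>Symmetry of the distance puts the entries of column \<open>u\<close> in the form
    used by the pairing lemmas, measured from \<open>u\<close>.\<close>
  have entry: "?D $ w $ u = q_int q (gdist G u w)" for u w
    by (simp add: q_distance_matrix_def gdist_commute[OF G(3), of w u])
  have M: "?M $ v $ w = ?x $ v / ?l * ?x $ w - L_mat q r X Y $ v $ w" for v w
    by (simp add: smult_mat_def matrix_matrix_mult_def columnvector_def rowvector_def)
  have "(?M ** ?D) $ v $ u = mat 1 $ v $ u" for v u
  proof -
    have "(?M ** ?D) $ v $ u = ?x $ v / ?l * (\<Sum>w\<in>UNIV. ?x $ w * q_int q (gdist G u w))
        - (\<Sum>w\<in>UNIV. L_mat q r X Y $ v $ w * q_int q (gdist G u w))"
      unfolding matrix_mult_nth M entry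
      by (simp add: left_diff_distrib sum_subtractf sum_distrib_left mult.assoc)
    \<comment> \<open>The first sum is \<open>?l\<close>, so the first product is
      \<open>?x $ v\<close>, which cancels against the second sum up to the indicator.\<close>
    also have "\<dots> = of_bool (v = u)"
      using assms(11) L_mat_qdist[OF q, of v u] x_vec_qdist[OF q, of u] D by simp
    finally show ?thesis by (simp add: mat_def)
  qed
  then have MD: "?M ** ?D = mat 1" by (simp add: vec_eq_iff)
  then have DM: "?D ** ?M = mat 1" by (simp only: matrix_left_right_inverse)
  have inv: "invertible ?D" unfolding invertible_def using MD DM by blast
  \<comment> \<open>\<open>matrix_inv\<close> is a choice of a two-sided inverse; multiplying by
    \<open>?M\<close> on the left identifies it.\<close>
  have "?D ** matrix_inv ?D = mat 1"
    unfolding matrix_inv_def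
    using someI[of "\<lambda>A'. ?D ** A' = mat 1 \<and> A' ** ?D = mat 1" ?M] MD DM by blast
  moreover have "?M ** (?D ** matrix_inv ?D) = matrix_inv ?D"
    unfolding matrix_mul_assoc MD by simp
  ultimately have "matrix_inv ?D = ?M" by simp
  then show ?thesis using inv by blast
qed

end
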